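(* Let $\Lambda>0$ and $a>0$. The function $y_{a,\Lambda}:[0,\Lambda]\to[0,\infty)$ defined by $$y_{a,\Lambda}(x)=\frac{a e^{-ax}}{1-e^{-a\Lambda}}$$ satisfies $\|y_{a,\Lambda}\|=1$ and is a fixed point of the operator $T_\Lambda$, i.e. $T_\Lambda y_{a,\Lambda}=y_{a,\Lambda}$ on $[0,\Lambda]$. Moreover its mean richness is $$\langle x\rangle_{y_{a,\Lambda}}=\frac1a+\frac{\Lambda}{1-e^{a\Lambda}}.$$
   Context: For $\Lambda>0$ and a nonnegative integrable function $y$ on $[0,\Lambda]$, put $\|y\|=\int_0^\Lambda y(x)\,dx$ and $\langle x\rangle_y=\int_0^\Lambda x\,y(x)\,dx$. The operator $T_\Lambda$ is defined, for $x\in[0,\Lambda]$, by $$[T_\Lambda y](x)=\iint_{\{u,v\ge 0,\ x\le u+v\le\Lambda\}}\frac{y(u)y(v)}{u+v}\,du\,dv+y(x)\int_{\Lambda-x}^{\Lambda}y(v)\,dv .$$ *)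

theory Defs
  imports "HOL-Analysis.Analysis"
begin

text \<open>
  A function on the interval \<open>[0, L]\<close> is represented by a total function on the reals; each of the
  three definitions below (the third for \<open>0 \<le> x \<le> L\<close>) depends only on its values on \<open>[0, L]\<close>.
  All integrals are Lebesgue integrals.
\<close>

definition mass :: "real \<Rightarrow> (real \<Rightarrow> real) \<Rightarrow> real" where
  "mass L y = (LINT x:{0..L}|lborel. y x)"

definition mean_richness :: "real \<Rightarrow> (real \<Rightarrow> real) \<Rightarrow> real" where
  "mean_richness L y = (LINT x:{0..L}|lborel. x * y x)"

text \<open>
  The double integral is taken with respect to Lebesgue measure on the plane. For \<open>x = 0\<close> its domain
  contains the origin, where the quotient is \<open>0\<close> by the convention for division; this is a null set.
\<close>

definition T_op :: "real \<Rightarrow> (real \<Rightarrow> real) \<Rightarrow> real \<Rightarrow> real" where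
  "T_op L y x =
     set_lebesgue_integral lborel {(u, v). 0 \<le> u \<and> 0 \<le> v \<and> x \<le> u + v \<and> u + v \<le> L}
       (\<lambda>(u, v). y u * y v / (u + v))
     + y x * (LINT v:{L - x..L}|lborel. y v)"

definition y_exp :: "real \<Rightarrow> real \<Rightarrow> real \<Rightarrow> real" where
  "y_exp a L x = a * exp (- a * x) / (1 - exp (- a * L))"

end

theory Submission
  imports Defs
begin

text \<open>
  Since \<open>y u * y v\<close> depends only on \<open>s = u + v\<close>, substituting \<open>v = s - u\<close> in the double integral
  makes the inner integral over \<open>0 \<le> u \<le> s\<close> contribute a factor \<open>s\<close>, which cancels the kernel
  \<open>1 / (u + v)\<close>. With \<open>c = a / (1 - exp (- a L))\<close> the gain and the return term become
  \<open>c\<^sup>2 / a * (exp (- a x) - exp (- a L))\<close> and \<open>c\<^sup>2 / a * (exp (- a L) - exp (- a x - a L))\<close>,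
  and their sum is \<open>c * exp (- a x)\<close>.
\<close>

lemma nn_integral_lborel_shift:
  fixes f :: "real \<Rightarrow> ennreal"
  assumes [measurable]: "f \<in> borel_measurable borel"
  shows "(\<integral>\<^sup>+v. f v \<partial>lborel) = (\<integral>\<^sup>+s. f (s - u) \<partial>lborel)"
  using nn_integral_real_affine[OF assms, of 1 "- u"] by simp

text \<open>As \<open>h\<close> is nonnegative, Tonelli applies to the sheared integrand without any
  prior integrability check. The Bochner integrals on both sides are then read off from one
  \<open>ennreal\<close> identity.\<close>

lemma set_integral_kernel_sum:
  fixes h :: "real \<Rightarrow> real"
  assumes [measurable]: "h \<in> borel_measurable borel"
    and nonneg: "\<And>s. 0 \<le> h s" and "0 \<le> x"
  shows "set_lebesgue_integral lborel {(u, v). 0 \<le> u \<and> 0 \<le> v \<and> x \<le> u + v \<and> u + v \<le> L}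
      (\<lambda>(u, v). h (u + v) / (u + v)) = (LINT s:{x..L}|lborel. h s)"
proof -
  define F :: "real \<Rightarrow> real \<Rightarrow> real" where
    "F u v = (if 0 \<le> u \<and> 0 \<le> v \<and> x \<le> u + v \<and> u + v \<le> L then h (u + v) / (u + v) else 0)" for u v
  have [measurable]: "(\<lambda>p. F (fst p) (snd p)) \<in> borel_measurable (lborel \<Otimes>\<^sub>M lborel)"
    unfolding F_def by measurable
  have [measurable]: "(\<lambda>p. F (fst p) (snd p)) \<in> borel_measurable (borel \<Otimes>\<^sub>M borel)"
    unfolding F_def by measurable
  have F_nonneg: "0 \<le> F u v" for u v
    using nonneg by (auto simp: F_def)
  \<comment> \<open>For fixed \<open>s\<close> in \<open>{x..L}\<close> the slice is
    \<open>0 \<le> u \<le> s\<close>, of length \<open>s\<close>. The point \<open>s = 0\<close> is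
    excluded: there division by zero makes the left side 0, while the right side can be
    \<open>h 0\<close>.\<close>
  have inner: "(\<integral>\<^sup>+u. ennreal (F u (s - u)) \<partial>lborel) = ennreal (indicator {x..L} s * h s)"
    if "s \<noteq> 0" for s
  proof -
    have "(\<integral>\<^sup>+u. ennreal (F u (s - u)) \<partial>lborel) =
        (\<integral>\<^sup>+u. ennreal (indicator {x..L} s * h s / s) * indicator {0..s} u \<partial>lborel)"
      by (intro nn_integral_cong) (auto simp: F_def indicator_def)
    also have "\<dots> = ennreal (indicator {x..L} s * h s / s) * emeasure lborel {0..s}"
      by (simp add: nn_integral_cmult)
    also have "\<dots> = ennreal (indicator {x..L} s * h s)"
      \<comment> \<open>For \<open>s < 0\<close> both sides vanish: the slice is empty, and
        \<open>s\<close> lies outside \<open>{x..L}\<close> because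
        \<open>0 \<le> x\<close>.\<close>
      using that nonneg[of s] \<open>0 \<le> x\<close>
      by (cases "0 \<le> s") (auto simp: indicator_def ennreal_mult[symmetric])
    finally show ?thesis .
  qed
  have "(\<integral>\<^sup>+p. ennreal (F (fst p) (snd p)) \<partial>(lborel \<Otimes>\<^sub>M lborel)) =
      (\<integral>\<^sup>+u. \<integral>\<^sup>+v. ennreal (F u v) \<partial>lborel \<partial>lborel)"
    using lborel.nn_integral_fst[of "\<lambda>p. ennreal (F (fst p) (snd p))" lborel] by simp
  also have "\<dots> = (\<integral>\<^sup>+u. \<integral>\<^sup>+s. ennreal (F u (s - u)) \<partial>lborel \<partial>lborel)"
    by (intro nn_integral_cong nn_integral_lborel_shift) (simp add: F_def)
  also have "\<dots> = (\<integral>\<^sup>+s. \<integral>\<^sup>+u. ennreal (F u (s - u)) \<partial>lborel \<partial>lborel)"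
    by (rule lborel_pair.Fubini') (simp add: F_def case_prod_beta)
  also have "\<dots> = (\<integral>\<^sup>+s. ennreal (indicator {x..L} s * h s) \<partial>lborel)"
    \<comment> \<open>The exceptional point \<open>s = 0\<close> is a null set.\<close>
    using AE_lborel_singleton[of 0] by (intro nn_integral_cong_AE) (auto simp: inner)
  finally have eq: "(\<integral>\<^sup>+p. ennreal (F (fst p) (snd p)) \<partial>(lborel \<Otimes>\<^sub>M lborel)) =
      (\<integral>\<^sup>+s. ennreal (indicator {x..L} s * h s) \<partial>lborel)" .
  have "set_lebesgue_integral lborel {(u, v). 0 \<le> u \<and> 0 \<le> v \<and> x \<le> u + v \<and> u + v \<le> L}
      (\<lambda>(u, v). h (u + v) / (u + v)) = (LINT p|(lborel \<Otimes>\<^sub>M lborel). F (fst p) (snd p))"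
    unfolding set_lebesgue_integral_def lborel_prod
    by (intro Bochner_Integration.integral_cong) (auto simp: F_def indicator_def)
  also have "\<dots> = (LINT s|lborel. indicator {x..L} s * h s)"
    using F_nonneg nonneg by (simp add: integral_eq_nn_integral eq)
  finally show ?thesis
    by (simp add: set_lebesgue_integral_def)
qed

text \<open>The \<open>has_bochner_integral\<close> form yields both the integrability of
  \<open>y_exp\<close> and the value of its integral.\<close>

lemma has_bochner_integral_exp_Icc:
  fixes a b c k :: real
  assumes "a \<noteq> 0" and "b \<le> c"
  shows "has_bochner_integral lborel (\<lambda>x. indicator {b..c} x *\<^sub>R (k * exp (- a * x)))
    (k / a * (exp (- a * b) - exp (- a * c)))"
proof -
  have "has_bochner_integral lborel (\<lambda>x. indicator {b..c} x *\<^sub>R (k * exp (- a * x)))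
      (- (k / a) * exp (- a * c) - - (k / a) * exp (- a * b))"
    using assms
    by (intro has_bochner_integral_FTC_Icc)
      (auto intro!: derivative_eq_intros continuous_intros
        simp flip: has_real_derivative_iff_has_vector_derivative)
  then show ?thesis
    by (simp add: algebra_simps)
qed

lemma set_integral_exp_Icc:
  fixes a b c k :: real
  assumes "a \<noteq> 0" and "b \<le> c"
  shows "(LINT x:{b..c}|lborel. k * exp (- a * x)) = k / a * (exp (- a * b) - exp (- a * c))"
  unfolding set_lebesgue_integral_def
  by (rule has_bochner_integral_integral_eq[OF has_bochner_integral_exp_Icc[OF assms]])

lemma set_integral_times_exp_Icc:
  fixes a b c k :: real
  assumes "a \<noteq> 0" and "b \<le> c"
  shows "(LINT x:{b..c}|lborel. x * (k * exp (- a * x))) =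
    k / a * ((b + 1 / a) * exp (- a * b) - (c + 1 / a) * exp (- a * c))"
proof -
  \<comment> \<open>Integration by parts gives the antiderivative
    \<open>- (k / a) * (x + 1 / a) * exp (- a * x)\<close>.\<close>
  have "has_bochner_integral lborel (\<lambda>x. indicator {b..c} x *\<^sub>R (x * (k * exp (- a * x))))
      (- (k / a) * (c + 1 / a) * exp (- a * c) - - (k / a) * (b + 1 / a) * exp (- a * b))"
    using assms
    by (intro has_bochner_integral_FTC_Icc)
      (auto intro!: derivative_eq_intros continuous_intros
        simp: field_simps simp flip: has_real_derivative_iff_has_vector_derivative)
  from has_bochner_integral_integral_eq[OF this] show ?thesis
    by (simp add: set_lebesgue_integral_def algebra_simps)
qed

theorem theorem8:
  fixes L a :: real
  assumes "L > 0" and "a > 0"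
  shows "(\<forall>x\<in>{0..L}. 0 \<le> y_exp a L x)
    \<and> set_integrable lborel {0..L} (y_exp a L)
    \<and> mass L (y_exp a L) = 1
    \<and> (\<forall>x\<in>{0..L}. T_op L (y_exp a L) x = y_exp a L x)
    \<and> mean_richness L (y_exp a L) = 1 / a + L / (1 - exp (a * L))"
proof (intro conjI ballI)
  define E where "E = exp (- a * L)"
  define c where "c = a / (1 - E)"
  have E: "0 < E" "E < 1"
    using assms by (auto simp: E_def)
  have c: "0 < c"
    using E assms by (simp add: c_def)
  have y: "y_exp a L = (\<lambda>x. c * exp (- a * x))"
    by (auto simp: y_exp_def c_def E_def)
  \<comment> \<open>The normalisation of \<open>y_exp\<close>: it gives the mass and also closes the
    fixed-point computation.\<close>
  have ca: "c / a * (1 - E) = 1"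
    using E assms by (simp add: c_def)
  show "0 \<le> y_exp a L x" for x
    using c by (simp add: y)
  show "set_integrable lborel {0..L} (y_exp a L)"
    unfolding set_integrable_def y
    using has_bochner_integral_exp_Icc[of a 0 L c] assms
    by (auto simp: has_bochner_integral_iff)
  show "mass L (y_exp a L) = 1"
    unfolding mass_def y
    using assms ca by (subst set_integral_exp_Icc) (auto simp: E_def)
  show "mean_richness L (y_exp a L) = 1 / a + L / (1 - exp (a * L))"
  proof -
    have "mean_richness L (y_exp a L) = c / a * (1 / a - (L + 1 / a) * E)"
      unfolding mean_richness_def y
      using assms by (subst set_integral_times_exp_Icc) (auto simp: E_def)
    \<comment> \<open>Here \<open>c / a = 1 / (1 - E)\<close>, and
      \<open>- E / (1 - E) = 1 / (1 - 1 / E)\<close>.\<close>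
    also have "\<dots> = 1 / a + L / (1 - 1 / E)"
      using E assms by (simp add: c_def divide_simps) (simp add: algebra_simps)
    also have "1 / E = exp (a * L)"
      by (simp add: E_def exp_minus field_simps)
    finally show ?thesis .
  qed
  show "T_op L (y_exp a L) x = y_exp a L x" if "x \<in> {0..L}" for x
  proof -
    define X where "X = exp (- a * x)"
    have "(\<lambda>(u, v). y_exp a L u * y_exp a L v / (u + v)) =
        (\<lambda>(u, v). (c\<^sup>2 * exp (- a * (u + v))) / (u + v))"
      by (auto simp: fun_eq_iff y power2_eq_square exp_add[symmetric] algebra_simps)
    then have "T_op L (y_exp a L) x =
        (LINT s:{x..L}|lborel. c\<^sup>2 * exp (- a * s)) + c * X * (LINT v:{L - x..L}|lborel. c * exp (- a * v))"
      using that set_integral_kernel_sum[of "\<lambda>s. c\<^sup>2 * exp (- a * s)" x L]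
      by (simp add: T_op_def y X_def)
    also have "\<dots> = c\<^sup>2 / a * (X - E) + c * X * (c / a * (exp (- a * (L - x)) - E))"
    proof -
      have "a \<noteq> 0" "x \<le> L" "L - x \<le> L"
        using that assms by auto
      then show ?thesis
        unfolding X_def E_def by (metis set_integral_exp_Icc)
    qed
    \<comment> \<open>The factor \<open>X\<close> from \<open>y_exp a L x\<close> absorbs the shift
      in the lower limit \<open>L - x\<close>.\<close>
    also have "\<dots> = c\<^sup>2 / a * (X - E) + c * (c / a * (E - X * E))"
    proof -
      have "X * exp (- a * (L - x)) = E"
        by (simp add: X_def E_def exp_add[symmetric] algebra_simps)
      then show ?thesis by (simp add: algebra_simps)
    qed
    \<comment> \<open>The lone \<open>E\<close> terms cancel:
      \<open>(X - E) + (E - X * E) = X * (1 - E)\<close>.\<close>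
    also have "\<dots> = c * X * (c / a * (1 - E))"
      by (simp add: power2_eq_square algebra_simps diff_divide_distrib add_divide_distrib)
    finally show ?thesis
      unfolding ca by (simp only: y X_def mult_1_right)
  qed
qed

end
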